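(* Let $X$ be a real-valued random variable that is non-degenerate (not almost surely constant) and discrete in the sense defined in the context. Then $X\notin\mathcal{D}^-$.
   Context: Discreteness: a real-valued random variable $X$ is called discrete if there are a countable index set $I\subset\mathbb{Z}$ and a set of real numbers $\{x_i : i\in I\}\subseteq\mathbb{R}$ with $x_i<x_j$ for $i<j$, such that $P(X=x_i)>0$ for all $i\in I$ and $\sum_{i\in I}P(X=x_i)=1$. Usual stochastic order: for real-valued random variables $X,Y$ with cumulative distribution functions $F_X(t)=P(X\le t)$ and $F_Y(t)=P(Y\le t)$, write $X\le_{st}Y$ if $F_X(t)\ge F_Y(t)$ for all $t\in\mathbb{R}$. The class $\mathcal{D}^-$: let $\Delta_n=\{(\theta_1,\dots,\theta_n)\in[0,1]^n : \sum_{i=1}^n\theta_i=1\}$. $\mathcal{D}^-$ is the set of distribution functions $F_X$ with the property that $$X_1\ \le_{st}\ \sum_{i=1}^n\theta_iX_i\quad\text{for all } n\in\mathbb{N}\text{ and all }(\theta_1,\dots,\theta_n)\in\Delta_n,$$ where $X_1,\dots,X_n$ are i.i.d. random variables with distribution function $F_X$. One writes $X\in\mathcal{D}^-$ if $F_X\in\mathcal{D}^-$. *)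

theory Defs
  imports "HOL-Probability.Probability"
begin

definition nondegenerate_rv :: "'a measure \<Rightarrow> ('a \<Rightarrow> real) \<Rightarrow> bool" where
  "nondegenerate_rv M X \<longleftrightarrow> \<not> (\<exists>c. AE \<omega> in M. X \<omega> = c)"

text \<open>Discreteness in the strong sense: the atoms can be listed in increasing order along a set
  of integers.  In particular, a set of atoms that is dense in an interval is excluded.
  Countability of \<open>I\<close> is automatic.\<close>

definition discrete_rv :: "'a measure \<Rightarrow> ('a \<Rightarrow> real) \<Rightarrow> bool" where
  "discrete_rv M X \<longleftrightarrow>
    (\<exists>(I :: int set) (x :: int \<Rightarrow> real).
        strict_mono_on I x \<and>
        (\<forall>i\<in>I. measure M {\<omega> \<in> space M. X \<omega> = x i} > 0) \<and>
        ((\<lambda>i. measure M {\<omega> \<in> space M. X \<omega> = x i}) has_sum 1) I)"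

definition st_le :: "'a measure \<Rightarrow> ('a \<Rightarrow> real) \<Rightarrow> 'b measure \<Rightarrow> ('b \<Rightarrow> real) \<Rightarrow> bool" where
  "st_le M X N Y \<longleftrightarrow> (\<forall>t. cdf (distr M borel X) t \<ge> cdf (distr N borel Y) t)"

text \<open>Only the coordinates \<open>1, \<dots>, n\<close> of \<open>\<theta>\<close> are relevant; the set is empty for \<open>n = 0\<close>.\<close>

definition weight_simplex :: "nat \<Rightarrow> (nat \<Rightarrow> real) set" where
  "weight_simplex n = {\<theta>. (\<forall>i\<in>{1..n}. \<theta> i \<in> {0..1}) \<and> (\<Sum>i=1..n. \<theta> i) = 1}"

definition iid_with_cdf ::
    "'a measure \<Rightarrow> nat \<Rightarrow> (nat \<Rightarrow> 'a \<Rightarrow> real) \<Rightarrow> (real \<Rightarrow> real) \<Rightarrow> bool" where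
  "iid_with_cdf N n Y F \<longleftrightarrow>
    prob_space N \<and>
    prob_space.indep_vars N (\<lambda>_. borel) Y {1..n} \<and>
    (\<forall>i\<in>{1..n}. cdf (distr N borel (Y i)) = F)"

text \<open>The i.i.d. variables range over all probability spaces on the type \<open>nat \<Rightarrow> real\<close>, as a
  definition cannot quantify over types. This is no restriction: for \<open>n \<ge> 1\<close>, every distribution function
  has i.i.d. samples on such a space (\<open>iid_with_cdf_exists\<close>), and the inequality carries over to
  i.i.d. samples on arbitrary probability spaces (\<open>D_minus_any_space\<close>).\<close>

definition D_minus :: "(real \<Rightarrow> real) set" where
  "D_minus = {F. (\<exists>\<mu>. real_distribution \<mu> \<and> F = cdf \<mu>) \<and>
    (\<forall>n. \<forall>\<theta>\<in>weight_simplex n. \<forall>(N :: (nat \<Rightarrow> real) measure) Y.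
        iid_with_cdf N n Y F \<longrightarrow>
        st_le N (Y 1) N (\<lambda>\<omega>. \<Sum>i=1..n. \<theta> i * Y i \<omega>))}"

lemma iid_with_cdf_PiM:
  assumes \<mu>: "real_distribution \<mu>" and n: "n \<ge> 1"
  shows "iid_with_cdf (Pi\<^sub>M {1..n} (\<lambda>_. \<mu>)) n (\<lambda>i \<omega>. \<omega> i) (cdf \<mu>)"
proof -
  interpret real_distribution \<mu> by (fact \<mu>)
  interpret P: product_prob_space "\<lambda>_::nat. \<mu>" "{1..n}" by unfold_locales
  let ?P = "Pi\<^sub>M {1..n} (\<lambda>_. \<mu>)"
  have PP: "prob_space ?P" by (rule prob_space_PiM) unfold_locales
  have d: "distr ?P borel (\<lambda>\<omega>. \<omega> i) = \<mu>" if "i \<in> {1..n}" for i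
  proof -
    have "distr ?P borel (\<lambda>\<omega>. \<omega> i) = distr ?P \<mu> (\<lambda>\<omega>. \<omega> i)"
      by (rule distr_cong) simp_all
    then show ?thesis using P.PiM_component[OF that] by simp
  qed
  have rv: "(\<lambda>\<omega>. \<omega> i) \<in> borel_measurable ?P" if "i \<in> {1..n}" for i
    using measurable_component_singleton[OF that, of "\<lambda>_. \<mu>"]
    by (simp cong: measurable_cong_sets)
  have "distr ?P (Pi\<^sub>M {1..n} (\<lambda>_. borel)) (\<lambda>\<omega>. \<lambda>i\<in>{1..n}. \<omega> i) = distr ?P ?P (\<lambda>\<omega>. \<omega>)"
  proof (rule distr_cong)
    show "sets (Pi\<^sub>M {1..n} (\<lambda>_. borel)) = sets ?P" by (rule sets_PiM_cong) simp_all
    show "(\<lambda>i\<in>{1..n}. \<omega> i) = \<omega>" if "\<omega> \<in> space ?P" for \<omega>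
      using that by (auto simp: space_PiM PiE_restrict)
  qed simp
  also have "\<dots> = ?P" by simp
  also have "\<dots> = Pi\<^sub>M {1..n} (\<lambda>i. distr ?P borel (\<lambda>\<omega>. \<omega> i))"
    by (rule PiM_cong) (simp_all only: d)
  finally have "prob_space.indep_vars ?P (\<lambda>_. borel) (\<lambda>i \<omega>. \<omega> i) {1..n}"
    using rv n by (subst prob_space.indep_vars_iff_distr_eq_PiM'[OF PP]) auto
  then show ?thesis using d PP by (simp add: iid_with_cdf_def)
qed

lemma iid_with_cdf_exists:
  assumes "real_distribution \<mu>" and "n \<ge> 1"
  shows "\<exists>(N :: (nat \<Rightarrow> real) measure) Y. iid_with_cdf N n Y (cdf \<mu>)"
  using iid_with_cdf_PiM[OF assms] by blast

lemma iid_with_cdf_distr: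
  assumes \<mu>: "real_distribution \<mu>" and iid: "iid_with_cdf N n Y (cdf \<mu>)" and n: "n \<ge> 1"
    and f: "f \<in> borel_measurable (Pi\<^sub>M {1..n} (\<lambda>_. borel))"
  shows "distr N borel (\<lambda>\<omega>. f (\<lambda>i\<in>{1..n}. Y i \<omega>)) = distr (Pi\<^sub>M {1..n} (\<lambda>_. \<mu>)) borel f"
proof -
  interpret prob_space N using iid by (simp add: iid_with_cdf_def)
  have ind: "indep_vars (\<lambda>_. borel) Y {1..n}" using iid by (simp add: iid_with_cdf_def)
  then have rv: "\<And>i. i \<in> {1..n} \<Longrightarrow> Y i \<in> borel_measurable N" by (simp add: indep_vars_def2)
  have d: "distr N borel (Y i) = \<mu>" if "i \<in> {1..n}" for i
    using cdf_unique[OF real_distribution_distr[OF rv[OF that]] \<mu>] iid that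
    by (auto simp: iid_with_cdf_def)
  have "distr N (Pi\<^sub>M {1..n} (\<lambda>_. borel)) (\<lambda>\<omega>. \<lambda>i\<in>{1..n}. Y i \<omega>) = Pi\<^sub>M {1..n} (\<lambda>i. distr N borel (Y i))"
    using ind rv n by (subst (asm) indep_vars_iff_distr_eq_PiM') auto
  also have "\<dots> = Pi\<^sub>M {1..n} (\<lambda>_. \<mu>)" by (rule PiM_cong) (auto simp: d)
  finally have *: "distr N (Pi\<^sub>M {1..n} (\<lambda>_. borel)) (\<lambda>\<omega>. \<lambda>i\<in>{1..n}. Y i \<omega>) = Pi\<^sub>M {1..n} (\<lambda>_. \<mu>)" .
  have "(\<lambda>\<omega>. \<lambda>i\<in>{1..n}. Y i \<omega>) \<in> measurable N (Pi\<^sub>M {1..n} (\<lambda>_. borel))"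
    using rv by (intro measurable_restrict) auto
  from distr_distr[OF f this] show ?thesis unfolding * by (simp add: comp_def)
qed

lemma D_minus_any_space:
  assumes F: "F \<in> D_minus" and \<theta>: "\<theta> \<in> weight_simplex n" and iid: "iid_with_cdf N n Y F"
  shows "st_le N (Y 1) N (\<lambda>\<omega>. \<Sum>i=1..n. \<theta> i * Y i \<omega>)"
proof -
  from F obtain \<mu> where \<mu>: "real_distribution \<mu>" and F_eq: "F = cdf \<mu>"
    by (auto simp: D_minus_def)
  have n: "n \<ge> 1" using \<theta> by (cases n) (auto simp: weight_simplex_def)
  let ?P = "Pi\<^sub>M {1..n} (\<lambda>_. \<mu>)"
  have "st_le ?P (\<lambda>\<omega>. \<omega> 1) ?P (\<lambda>\<omega>. \<Sum>i=1..n. \<theta> i * \<omega> i)"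
    using F \<theta> iid_with_cdf_PiM[OF \<mu> n] unfolding D_minus_def F_eq by blast
  moreover have "distr N borel (Y 1) = distr ?P borel (\<lambda>\<omega>. \<omega> 1)"
    using iid_with_cdf_distr[OF \<mu> iid[unfolded F_eq] n, of "\<lambda>\<omega>. \<omega> 1"] n by simp
  moreover have "distr N borel (\<lambda>\<omega>. \<Sum>i=1..n. \<theta> i * Y i \<omega>)
      = distr ?P borel (\<lambda>\<omega>. \<Sum>i=1..n. \<theta> i * \<omega> i)"
    using iid_with_cdf_distr[OF \<mu> iid[unfolded F_eq] n, of "\<lambda>\<omega>. \<Sum>i=1..n. \<theta> i * \<omega> i"] by simp
  ultimately show ?thesis by (simp add: st_le_def)
qed

end

theory Submission
  imports Defs
begin

text \<open>
  An increasing enumeration of the atoms along a set of integers leaves gaps: if there are at least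
  two atoms, then some atom \<open>a\<close> has an immediate successor \<open>b\<close>, and the open interval between them
  carries no mass (\<open>discrete_rv_gap\<close>). A gap below an atom already excludes membership in
  \<open>\<D>\<^sup>-\<close> (\<open>cdf_gap_not_in_D_minus\<close>), and two summands suffice to see this.

  Put almost all the weight on \<open>X\<^sub>1\<close> and compare the distribution functions at the point
  \<open>t = (1 - \<epsilon>) b + \<epsilon> a\<close> just below \<open>b\<close>. Since \<open>t\<close> lies in the gap, \<open>F t = F a\<close>.
  The average \<open>(1 - \<epsilon>) X\<^sub>1 + \<epsilon> X\<^sub>2\<close> is at most \<open>t\<close> in two disjoint cases. If
  \<open>X\<^sub>1 \<le> a\<close>, it suffices that \<open>X\<^sub>2 \<le> L\<close> for a bound \<open>L\<close> which grows like
  \<open>(b - a) / \<epsilon>\<close>, so this case loses only a vanishing part of the mass \<open>F a\<close> as \<open>\<epsilon> \<rightarrow> 0\<close>.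
  If \<open>X\<^sub>1 = b\<close>, any \<open>X\<^sub>2 \<le> a\<close> pulls the average down to \<open>t\<close>, which contributes
  \<open>P(X = b) F a\<close>, a positive amount independent of \<open>\<epsilon>\<close>. For small \<open>\<epsilon>\<close> the
  average thus has more than \<open>F a\<close> of its mass in \<open>(-\<infinity>, t]\<close>, against the stochastic order.
\<close>

lemma measure_PiM_pair_box:
  fixes \<mu> :: "real measure"
  assumes "real_distribution \<mu>" and "A \<in> sets borel" and "B \<in> sets borel"
  shows "measure (Pi\<^sub>M {1..2::nat} (\<lambda>_. \<mu>))
           (Pi\<^sub>E {1..2} (\<lambda>i. if i = 1 then A else B)) = measure \<mu> A * measure \<mu> B"
proof -
  interpret real_distribution \<mu> by fact
  interpret finite_product_prob_space "\<lambda>_::nat. \<mu>" "{1..2}"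
    by unfold_locales auto
  have "{1..2::nat} = {1, 2}" by auto
  then show ?thesis
    using assms(2,3) by (subst finite_measure_PiM_emb) auto
qed

text \<open>The two boxes correspond to the two ways in which the average can stay below \<open>t\<close>:
  \<open>X\<^sub>1\<close> is at most \<open>a\<close> and \<open>X\<^sub>2\<close> is not too large, or \<open>X\<^sub>1\<close> equals \<open>b\<close> and
  \<open>X\<^sub>2\<close> is at most \<open>a\<close>. They are disjoint because \<open>a < b\<close>.\<close>

lemma D_minus_two_point_bound:
  assumes \<mu>: "real_distribution \<mu>" and D: "cdf \<mu> \<in> D_minus"
    and ab: "a < b" and \<epsilon>: "0 \<le> \<epsilon>" "\<epsilon> \<le> 1"
    and tb: "(1 - \<epsilon>) * b + \<epsilon> * a \<le> t" and tL: "(1 - \<epsilon>) * a + \<epsilon> * L \<le> t"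
  shows "cdf \<mu> a * cdf \<mu> L + measure \<mu> {b} * cdf \<mu> a \<le> cdf \<mu> t"
proof -
  interpret real_distribution \<mu> by fact
  let ?N = "Pi\<^sub>M {1..2::nat} (\<lambda>_. \<mu>)"
  define \<theta> :: "nat \<Rightarrow> real" where "\<theta> i = (if i = 1 then 1 - \<epsilon> else \<epsilon>)" for i
  define S where "S \<omega> = (\<Sum>i=1..2. \<theta> i * \<omega> i)" for \<omega> :: "nat \<Rightarrow> real"
  define A where "A = Pi\<^sub>E {1..2::nat} (\<lambda>i. if i = 1 then {..a} else {..L})"
  define B where "B = Pi\<^sub>E {1..2::nat} (\<lambda>i. if i = 1 then {b} else {..a})"
  have I2: "{1..2::nat} = {1, 2}" "{Suc 0..2} = {1, 2}" by auto
  interpret N: prob_space ?N by (rule prob_space_PiM) unfold_locales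
  have S_eq: "S \<omega> = (1 - \<epsilon>) * \<omega> 1 + \<epsilon> * \<omega> 2" for \<omega>
    unfolding S_def I2 by (simp add: \<theta>_def)
  have iid: "iid_with_cdf ?N 2 (\<lambda>i \<omega>. \<omega> i) (cdf \<mu>)"
    by (rule iid_with_cdf_PiM[OF \<mu>]) simp
  have "\<theta> \<in> weight_simplex 2"
    using \<epsilon> unfolding weight_simplex_def I2 by (auto simp: \<theta>_def)
  then have "st_le ?N (\<lambda>\<omega>. \<omega> 1) ?N S"
    using D iid unfolding D_minus_def S_def[abs_def] by blast
  then have le: "cdf (distr ?N borel S) t \<le> cdf \<mu> t"
    using iid by (auto simp: st_le_def iid_with_cdf_def)
  have comp: "(\<lambda>\<omega>. \<omega> i) \<in> borel_measurable ?N" if "i \<in> {1..2}" for i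
    using measurable_component_singleton[OF that, of "\<lambda>_. \<mu>"]
    by (simp cong: measurable_cong_sets)
  have S_meas: "S \<in> borel_measurable ?N"
    unfolding S_def[abs_def] using comp by (intro borel_measurable_sum borel_measurable_times) auto
  have sets: "A \<in> sets ?N" "B \<in> sets ?N"
    unfolding A_def B_def by (auto intro!: sets_PiM_I_finite)
  have "A \<inter> B = {}"
    using ab by (auto simp: A_def B_def PiE_iff I2)
  then have "measure ?N A + measure ?N B = measure ?N (A \<union> B)"
    using sets by (intro N.finite_measure_Union[symmetric])
  also have "\<dots> \<le> measure ?N (S -` {..t} \<inter> space ?N)"
  proof (rule N.finite_measure_mono)
    have "S \<omega> \<le> t" if "\<omega> \<in> A" for \<omega>
    proof -
      have "\<omega> 1 \<le> a" "\<omega> 2 \<le> L" using that by (auto simp: A_def PiE_iff I2)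
      then have "(1 - \<epsilon>) * \<omega> 1 + \<epsilon> * \<omega> 2 \<le> (1 - \<epsilon>) * a + \<epsilon> * L"
        using \<epsilon> by (intro add_mono mult_left_mono) auto
      with tL show ?thesis by (simp add: S_eq)
    qed
    moreover have "S \<omega> \<le> t" if "\<omega> \<in> B" for \<omega>
    proof -
      have "\<omega> 1 = b" "\<omega> 2 \<le> a" using that by (auto simp: B_def PiE_iff I2)
      then have "(1 - \<epsilon>) * \<omega> 1 + \<epsilon> * \<omega> 2 \<le> (1 - \<epsilon>) * b + \<epsilon> * a"
        using \<epsilon> by (intro add_mono mult_left_mono) auto
      with tb show ?thesis by (simp add: S_eq)
    qed
    ultimately show "A \<union> B \<subseteq> S -` {..t} \<inter> space ?N"
      using sets[THEN sets.sets_into_space] by auto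
  qed (use S_meas in auto)
  also have "\<dots> = cdf (distr ?N borel S) t"
    using S_meas by (simp add: cdf_def measure_distr)
  finally have "measure ?N A + measure ?N B \<le> cdf \<mu> t" using le by linarith
  then show ?thesis
    using measure_PiM_pair_box[OF \<mu>, of "{..a}" "{..L}"] measure_PiM_pair_box[OF \<mu>, of "{b}" "{..a}"]
    by (simp add: A_def B_def cdf_def)
qed

text \<open>Letting the second weight tend to \<open>0\<close> in the bound above leaves
  \<open>F a + P(X = b) F a \<le> F a\<close>, which is absurd.\<close>

lemma cdf_gap_not_in_D_minus:
  assumes \<mu>: "real_distribution \<mu>" and ab: "a < b"
    and gap: "measure \<mu> {a<..<b} = 0" and a: "cdf \<mu> a > 0" and b: "measure \<mu> {b} > 0"
  shows "cdf \<mu> \<notin> D_minus"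
proof
  assume D: "cdf \<mu> \<in> D_minus"
  interpret real_distribution \<mu> by fact
  have "eventually (\<lambda>L. 1 - measure \<mu> {b} < cdf \<mu> L) at_top"
    using b by (intro order_tendstoD[OF cdf_lim_at_top_prob]) auto
  then obtain L where L: "1 - measure \<mu> {b} < cdf \<mu> L" "b < L"
    using eventually_conj[OF _ eventually_gt_at_top[of b]]
    by (metis (mono_tags, lifting) eventually_happens' trivial_limit_at_top_linorder)
  \<comment> \<open>This weight equalises the two averages \<open>(1 - \<epsilon>) b + \<epsilon> a\<close> and \<open>(1 - \<epsilon>) a + \<epsilon> L\<close>.\<close>
  define \<epsilon> where "\<epsilon> = (b - a) / ((b - a) + (L - a))"
  define t where "t = (1 - \<epsilon>) * b + \<epsilon> * a"
  have \<epsilon>: "0 < \<epsilon>" "\<epsilon> < 1" using ab L by (auto simp: \<epsilon>_def)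
  have "\<epsilon> * ((b - a) + (L - a)) = b - a" using ab L by (simp add: \<epsilon>_def)
  then have tL: "(1 - \<epsilon>) * a + \<epsilon> * L = t" by (simp add: t_def algebra_simps)
  have t_eq: "t = a + (1 - \<epsilon>) * (b - a)" "t = b - \<epsilon> * (b - a)"
    by (auto simp: t_def algebra_simps)
  have at: "a < t" using \<epsilon> ab by (simp add: t_eq(1))
  have "t < b" using \<epsilon> ab by (simp add: t_eq(2))
  have "measure \<mu> {a<..t} \<le> measure \<mu> {a<..<b}"
    using \<open>t < b\<close> by (intro finite_measure_mono) auto
  then have "measure \<mu> {a<..t} = 0" using gap by (simp add: measure_le_0_iff)
  then have "cdf \<mu> t = cdf \<mu> a" using cdf_diff_eq[OF at] by simp
  then have "cdf \<mu> a * cdf \<mu> L + measure \<mu> {b} * cdf \<mu> a \<le> cdf \<mu> a"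
    using D_minus_two_point_bound[OF \<mu> D ab, of \<epsilon> t L] \<epsilon> tL by (simp add: t_def)
  then have "cdf \<mu> a * (cdf \<mu> L + measure \<mu> {b}) \<le> cdf \<mu> a * 1"
    by (simp add: algebra_simps)
  with a L show False by simp
qed

lemma (in prob_space) measure_eq_0_if_disjoint_full_mass:
  assumes sum: "((\<lambda>i. measure M (E i)) has_sum 1) I"
    and E: "\<And>i. i \<in> I \<Longrightarrow> E i \<in> events" and disj: "disjoint_family_on E I"
    and G: "G \<in> events" "\<And>i. i \<in> I \<Longrightarrow> G \<inter> E i = {}"
  shows "measure M G = 0"
proof (rule ccontr)
  assume "measure M G \<noteq> 0"
  then have "1 - measure M G < 1" by (simp add: zero_less_measure_iff)
  then have "eventually (\<lambda>J. 1 - measure M G < (\<Sum>i\<in>J. measure M (E i)))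
      (finite_subsets_at_top I)"
    using sum unfolding has_sum_def by (intro order_tendstoD)
  then obtain J where J: "finite J" "J \<subseteq> I" "1 - measure M G < (\<Sum>i\<in>J. measure M (E i))"
    unfolding eventually_finite_subsets_at_top by blast
  have "(\<Sum>i\<in>J. measure M (E i)) = measure M (\<Union>i\<in>J. E i)"
    using J E disjoint_family_on_mono[OF J(2) disj]
    by (intro finite_measure_finite_Union[symmetric]) auto
  moreover have "measure M G + measure M (\<Union>i\<in>J. E i) = measure M (G \<union> (\<Union>i\<in>J. E i))"
    using J E G by (intro finite_measure_Union[symmetric]) auto
  ultimately show False using J(3) prob_le_1[of "G \<union> (\<Union>i\<in>J. E i)"] by linarith
qed

text \<open>This is the only place where the index set has to consist of integers: above an element that
  is not the largest there is a least one. A countable set of atoms that is dense in an interval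
  has no two neighbours.\<close>

lemma discrete_rv_gap:
  assumes M: "prob_space M" and X: "X \<in> borel_measurable M"
    and nd: "nondegenerate_rv M X" and disc: "discrete_rv M X"
  obtains a b where "a < b" "measure (distr M borel X) {a<..<b} = 0"
    "measure (distr M borel X) {a} > 0" "measure (distr M borel X) {b} > 0"
proof -
  interpret prob_space M by fact
  define E where "E c = {\<omega> \<in> space M. X \<omega> = c}" for c
  have E: "E c \<in> events" for c using X unfolding E_def by measurable
  have atom: "measure (distr M borel X) {c} = measure M (E c)" for c
    using X by (subst measure_distr) (auto simp: E_def intro!: arg_cong[of _ _ "measure M"])
  from disc obtain I :: "int set" and x where x: "strict_mono_on I x"
    and pos: "\<forall>i\<in>I. measure M (E (x i)) > 0"
    and sum: "((\<lambda>i. measure M (E (x i))) has_sum 1) I"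
    unfolding discrete_rv_def E_def[symmetric] by (elim exE conjE)
  have "I \<noteq> {}" using infsumI[OF sum] by auto
  then obtain i0 where i0: "i0 \<in> I" by blast
  have "I \<noteq> {i0}"
  proof
    assume "I = {i0}"
    then have "prob (E (x i0)) = 1"
      using infsumI[OF sum] by simp
    then have "AE \<omega> in M. X \<omega> = x i0"
      using AE_prob_1[of "E (x i0)"] by (auto simp: E_def)
    with nd show False by (auto simp: nondegenerate_rv_def)
  qed
  with i0 obtain i k where ik: "i \<in> I" "k \<in> I" "i < k"
    by (metis insertI1 linorder_neqE subsetI subset_singletonD singletonI equals0D)
  define j where "j = Min (I \<inter> {i<..k})"
  have fin: "finite (I \<inter> {i<..k})" "I \<inter> {i<..k} \<noteq> {}" using ik by auto
  have j: "j \<in> I" "i < j" "j \<le> k" using Min_in[OF fin] by (auto simp: j_def)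
  have next_index: "l \<le> i \<or> j \<le> l" if "l \<in> I" for l
    using Min_le[OF fin(1), of l, folded j_def] j that by (cases "i < l"; cases "l \<le> k") auto
  have "x i < x j" using x ik j by (auto dest: strict_mono_onD)
  have "measure M {\<omega> \<in> space M. x i < X \<omega> \<and> X \<omega> < x j} = 0"
  proof (rule measure_eq_0_if_disjoint_full_mass[OF sum])
    show "disjoint_family_on (\<lambda>i. E (x i)) I"
      using strict_mono_on_imp_inj_on[OF x]
      by (auto simp: disjoint_family_on_def E_def dest: inj_onD)
    show "{\<omega> \<in> space M. x i < X \<omega> \<and> X \<omega> < x j} \<in> events" using X by measurable
    show "{\<omega> \<in> space M. x i < X \<omega> \<and> X \<omega> < x j} \<inter> E (x l) = {}" if l: "l \<in> I" for l
    proof -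
      have "x l \<le> x i \<or> x j \<le> x l"
        using next_index[OF l] strict_mono_on_leD[OF x] l ik(1) j(1) by blast
      then show ?thesis by (auto simp: E_def)
    qed
  qed (rule E)
  also have "{\<omega> \<in> space M. x i < X \<omega> \<and> X \<omega> < x j} = X -` {x i<..<x j} \<inter> space M" by auto
  finally have "measure (distr M borel X) {x i<..<x j} = 0" using X by (simp add: measure_distr)
  with that \<open>x i < x j\<close> pos ik j show thesis by (simp add: atom)
qed

theorem theorem2p3:
  fixes M :: "'a measure" and X :: "'a \<Rightarrow> real"
  assumes "prob_space M"
    and "X \<in> borel_measurable M"
    and "nondegenerate_rv M X"
    and "discrete_rv M X"
  shows "cdf (distr M borel X) \<notin> D_minus"
proof -
  interpret prob_space M by fact
  interpret X: real_distribution "distr M borel X"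
    using assms(2) by (rule real_distribution_distr)
  obtain a b where ab: "a < b" "measure (distr M borel X) {a<..<b} = 0"
    "measure (distr M borel X) {a} > 0" "measure (distr M borel X) {b} > 0"
    using discrete_rv_gap[OF assms] .
  have "measure (distr M borel X) {a} \<le> cdf (distr M borel X) a"
    unfolding cdf_def by (rule X.finite_measure_mono) auto
  with ab show ?thesis
    by (intro cdf_gap_not_in_D_minus[OF X.real_distribution_axioms ab(1)]) auto
qed

end
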